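(* Let $r\geq 2$ be an integer and let $G$ be a bipartite graph with maximum degree $\Delta(G)=2r-1$ such that $d_G(v)\in\{1,2,2r-2,2r-1\}$ for every $v\in V(G)$. Then $G$ is cyclically interval colorable and $w_c(G)\leq 2r$.
   Context: All graphs are finite and undirected; multiple edges are allowed, loops are not. A proper $t$-edge coloring of $G$ is a map $\alpha:E(G)\to\{1,\dots,t\}$ with $\alpha(e)\neq\alpha(e')$ for adjacent edges $e,e'$; $S(v,\alpha)$ is the set of colors on edges incident to $v$. A proper $t$-edge coloring $\alpha$ is a cyclic interval $t$-coloring if for every vertex $v$, either $S(v,\alpha)$ or $\{1,\dots,t\}\setminus S(v,\alpha)$ is a set of consecutive integers. A graph is cyclically interval colorable if it has a cyclic interval $t$-coloring for some positive integer $t$, and then $w_c(G)$ denotes the least such $t$. *)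

theory Defs
  imports Main
begin

text \<open>Finite undirected multigraphs without loops. Edges are named objects, so that several
  edges may have the same two ends; \<open>card (ends G e) = 2\<close> excludes loops.\<close>

record ('v, 'e) multigraph =
  verts :: "'v set"
  edges :: "'e set"
  ends :: "'e \<Rightarrow> 'v set"

locale finite_multigraph =
  fixes G :: "('v, 'e) multigraph"
  assumes finite_verts: "finite (verts G)"
    and finite_edges: "finite (edges G)"
    and ends_subset: "e \<in> edges G \<Longrightarrow> ends G e \<subseteq> verts G"
    and card_ends: "e \<in> edges G \<Longrightarrow> card (ends G e) = 2"

definition incident_edges :: "('v, 'e) multigraph \<Rightarrow> 'v \<Rightarrow> 'e set" where
  "incident_edges G v = {e \<in> edges G. v \<in> ends G e}"

definition degree :: "('v, 'e) multigraph \<Rightarrow> 'v \<Rightarrow> nat" where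
  "degree G v = card (incident_edges G v)"

text \<open>The inserted \<open>0\<close> only serves to give the graph without vertices maximum degree \<open>0\<close>.\<close>

definition max_degree :: "('v, 'e) multigraph \<Rightarrow> nat" where
  "max_degree G = Max (insert 0 (degree G ` verts G))"

definition bipartite :: "('v, 'e) multigraph \<Rightarrow> bool" where
  "bipartite G \<longleftrightarrow>
    (\<exists>X Y. X \<union> Y = verts G \<and> X \<inter> Y = {} \<and>
      (\<forall>e \<in> edges G. \<exists>x \<in> X. \<exists>y \<in> Y. ends G e = {x, y}))"

definition adjacent_edges :: "('v, 'e) multigraph \<Rightarrow> 'e \<Rightarrow> 'e \<Rightarrow> bool" where
  "adjacent_edges G e e' \<longleftrightarrow> e \<noteq> e' \<and> ends G e \<inter> ends G e' \<noteq> {}"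

definition proper_edge_coloring ::
    "('v, 'e) multigraph \<Rightarrow> nat \<Rightarrow> ('e \<Rightarrow> nat) \<Rightarrow> bool" where
  "proper_edge_coloring G t \<alpha> \<longleftrightarrow>
    (\<forall>e \<in> edges G. \<alpha> e \<in> {1..t}) \<and>
    (\<forall>e \<in> edges G. \<forall>e' \<in> edges G. adjacent_edges G e e' \<longrightarrow> \<alpha> e \<noteq> \<alpha> e')"

definition colors_at :: "('v, 'e) multigraph \<Rightarrow> 'v \<Rightarrow> ('e \<Rightarrow> nat) \<Rightarrow> nat set" where
  "colors_at G v \<alpha> = \<alpha> ` incident_edges G v"

text \<open>The empty set counts as consecutive (take \<open>a > b\<close>). This has no effect below: of
  \<open>S\<close> and \<open>{1..t} - S\<close>, if one is empty then the other is \<open>{1..t}\<close>.\<close>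

definition consecutive :: "nat set \<Rightarrow> bool" where
  "consecutive S \<longleftrightarrow> (\<exists>a b. S = {a..b})"

definition cyclic_interval_coloring ::
    "('v, 'e) multigraph \<Rightarrow> nat \<Rightarrow> ('e \<Rightarrow> nat) \<Rightarrow> bool" where
  "cyclic_interval_coloring G t \<alpha> \<longleftrightarrow>
    proper_edge_coloring G t \<alpha> \<and>
    (\<forall>v \<in> verts G. consecutive (colors_at G v \<alpha>) \<or> consecutive ({1..t} - colors_at G v \<alpha>))"

definition cyclically_interval_colorable :: "('v, 'e) multigraph \<Rightarrow> bool" where
  "cyclically_interval_colorable G \<longleftrightarrow> (\<exists>t > 0. \<exists>\<alpha>. cyclic_interval_coloring G t \<alpha>)"

text \<open>Meaningful only for cyclically interval colorable graphs.\<close>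

definition w_c :: "('v, 'e) multigraph \<Rightarrow> nat" where
  "w_c G = (LEAST t. t > 0 \<and> (\<exists>\<alpha>. cyclic_interval_coloring G t \<alpha>))"

end

theory Submission
  imports Defs
begin

text \<open>Split the edges into red and blue ones as evenly as possible at every vertex and orient red
  edges from one side of the bipartition to the other and blue edges the opposite way. At a vertex with equal in- and
  out-degree \<open>k\<close> add \<open>r - k\<close> directed loops. By Koenig's edge coloring theorem, applied to the
  bipartite graph with a tail copy and a head copy of each vertex, the arcs get \<open>r\<close> colors such
  that arcs with a common tail, or with a common head, differ. A vertex of even degree then sees all
  \<open>r\<close> colors both as a tail and as a head, and a loop uses its color on both sides; hence the red
  and the blue edges at this vertex have the same set \<open>C\<close> of colors. Giving a red edge of color \<open>i\<close>
  the color \<open>2 * i + 1\<close> and a blue one \<open>2 * i + 2\<close>, the colors at this vertex are the union of the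
  blocks \<open>{2 * i + 1, 2 * i + 2}\<close> over \<open>C\<close>. For degree \<open>2\<close> this is one block, for degree
  \<open>2 * r - 2\<close> it is all blocks but one; at the degrees \<open>1\<close> and \<open>2 * r - 1\<close> there is nothing to
  achieve.\<close>

section \<open>Two-colorings of bipartite multigraphs of maximum degree two\<close>

text \<open>Below, a bipartite multigraph is given by two maps \<open>f\<close> and \<open>g\<close> sending an edge to its end on
  either side. That the coloring \<open>c\<close> is proper at the vertices of the first side is written
  \<open>inj_on (\<lambda>e. (f e, c e)) E\<close>.\<close>

definition at_most_two :: "'e set \<Rightarrow> ('e \<Rightarrow> 'a) \<Rightarrow> bool" where
  "at_most_two E f \<longleftrightarrow>
    (\<forall>x\<in>E. \<forall>y\<in>E. \<forall>z\<in>E. f x = f y \<and> f y = f z \<longrightarrow> x = y \<or> y = z \<or> x = z)"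

lemma at_most_two_subset: "at_most_two E f \<Longrightarrow> D \<subseteq> E \<Longrightarrow> at_most_two D f"
  unfolding at_most_two_def by blast

lemma at_most_twoD:
  "at_most_two E f \<Longrightarrow> x \<in> E \<Longrightarrow> y \<in> E \<Longrightarrow> z \<in> E \<Longrightarrow> f x = f y \<Longrightarrow> f y = f z
    \<Longrightarrow> x = y \<or> y = z \<or> x = z"
  unfolding at_most_two_def by blast

text \<open>The components are paths and even cycles, so colors can alternate. Instead of tracing
  components, the induction on the number of edges removes an edge \<open>e\<close> without a
  partner at one of its ends, removes a pair of parallel edges, or contracts a path of three edges
  to one edge, which keeps the alternation intact.\<close>

lemma two_coloring_exists:
  fixes f g :: "'e \<Rightarrow> 'a"
  assumes "finite E" "at_most_two E f" "at_most_two E g"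
  shows "\<exists>c :: 'e \<Rightarrow> bool. inj_on (\<lambda>e. (f e, c e)) E \<and> inj_on (\<lambda>e. (g e, c e)) E"
  using assms
proof (induction "card E" arbitrary: E f g rule: less_induct)
  case less
  show ?case
  proof (cases "E = {}")
    case True
    then show ?thesis by simp
  next
    case False
    then obtain e where e: "e \<in> E" by blast
    have IH: "\<exists>c :: 'e \<Rightarrow> bool. inj_on (\<lambda>e. (p e, c e)) D \<and> inj_on (\<lambda>e. (q e, c e)) D"
      if "D \<subseteq> E - {e}" "at_most_two D p" "at_most_two D q" for D and p q :: "'e \<Rightarrow> 'a"
    proof (rule less.hyps)
      show "card D < card E"
        using that(1) e less.prems(1)
        by (metis card_Diff1_less card_mono finite_Diff le_less_trans)
      show "finite D"
        using that(1) less.prems(1) by (meson finite_Diff finite_subset)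
    qed (use that in auto)
    \<comment> \<open>If \<open>e\<close> is alone at its \<open>p\<close>-end, only its
      \<open>q\<close>-end restricts its color, and there at most one other edge does. With
      \<open>p\<close> and \<open>q\<close> variable, the two sides can be swapped.\<close>
    have no_partner: "\<exists>c :: 'e \<Rightarrow> bool. inj_on (\<lambda>e. (p e, c e)) E \<and> inj_on (\<lambda>e. (q e, c e)) E"
      if pq: "at_most_two E p" "at_most_two E q"
        and alone: "\<And>x. x \<in> E \<Longrightarrow> p x = p e \<Longrightarrow> x = e" for p q :: "'e \<Rightarrow> 'a"
    proof -
      obtain c :: "'e \<Rightarrow> bool" where
        c: "inj_on (\<lambda>e. (p e, c e)) (E - {e})" "inj_on (\<lambda>e. (q e, c e)) (E - {e})"
        using IH[of "E - {e}" p q] pq by (meson at_most_two_subset Diff_subset subset_refl)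
      have "\<exists>b. \<forall>x\<in>E - {e}. q x = q e \<longrightarrow> c x \<noteq> b"
      proof (cases "\<exists>y\<in>E - {e}. q y = q e")
        case True
        then obtain y where y: "y \<in> E - {e}" "q y = q e" by blast
        have "x = y" if "x \<in> E - {e}" "q x = q e" for x
          using at_most_twoD[OF pq(2), of x y e] that y e by auto
        then show ?thesis by (intro exI[of _ "\<not> c y"]) auto
      qed auto
      then obtain b where "\<forall>x\<in>E - {e}. q x = q e \<longrightarrow> c x \<noteq> b" by blast
      then have b: "c x \<noteq> b" if "x \<in> E" "x \<noteq> e" "q x = q e" for x
        using that by blast
      define c' where "c' = c(e := b)"
      have c': "c' e = b" "\<And>x. x \<noteq> e \<Longrightarrow> c' x = c x" by (auto simp: c'_def)
      have "inj_on (\<lambda>e. (p e, c' e)) E"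
      proof (rule inj_onI)
        fix x y assume "x \<in> E" "y \<in> E" "(p x, c' x) = (p y, c' y)"
        moreover have "x = y" if "x \<noteq> e" "y \<noteq> e"
          using inj_onD[OF c(1), of x y] that c' calculation by simp
        ultimately show "x = y" using alone by (metis prod.inject)
      qed
      moreover have "inj_on (\<lambda>e. (q e, c' e)) E"
      proof (rule inj_onI)
        fix x y assume "x \<in> E" "y \<in> E" "(q x, c' x) = (q y, c' y)"
        moreover have "x = y" if "x \<noteq> e" "y \<noteq> e"
          using inj_onD[OF c(2), of x y] that c' calculation by simp
        ultimately show "x = y" using b c' by (metis prod.inject)
      qed
      ultimately show ?thesis by blast
    qed
    show ?thesis
    proof (cases "(\<exists>x\<in>E. f x = f e \<and> x \<noteq> e) \<and> (\<exists>x\<in>E. g x = g e \<and> x \<noteq> e)")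
      case False
      then consider "\<And>x. x \<in> E \<Longrightarrow> f x = f e \<Longrightarrow> x = e" | "\<And>x. x \<in> E \<Longrightarrow> g x = g e \<Longrightarrow> x = e"
        by blast
      then show ?thesis
        using no_partner[of f g] no_partner[of g f] less.prems by cases blast+
    next
      case True
      then obtain e1 where e1: "e1 \<in> E" "f e1 = f e" "e1 \<noteq> e" by blast
      from True obtain e2 where e2: "e2 \<in> E" "g e2 = g e" "e2 \<noteq> e" by blast
      have fe: "x = e \<or> x = e1" if "x \<in> E" "f x = f e" for x
        using at_most_twoD[OF less.prems(2), of x e e1] that e e1 by metis
      have ge: "x = e \<or> x = e2" if "x \<in> E" "g x = g e" for x
        using at_most_twoD[OF less.prems(3), of x e e2] that e e2 by metis
      \<comment> \<open>Both remaining cases drop \<open>e\<close> and \<open>e1\<close>: if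
        \<open>e1 = e2\<close>, these two edges form a cycle; otherwise \<open>e2\<close> stays to
        represent the contracted path.\<close>
      define D where "D = E - {e, e1}"
      have D: "D \<subseteq> E - {e}" "D \<subseteq> E" by (auto simp: D_def)
      show ?thesis
      proof (cases "e1 = e2")
        case True
        obtain c :: "'e \<Rightarrow> bool" where
          c: "inj_on (\<lambda>e. (f e, c e)) D" "inj_on (\<lambda>e. (g e, c e)) D"
          using IH[OF D(1)] less.prems D(2) by (meson at_most_two_subset)
        define c' where "c' = c(e := True, e1 := False)"
        have c'e: "c' e" "\<not> c' e1" "\<And>x. x \<in> D \<Longrightarrow> c' x = c x"
          using e1(3) by (auto simp: c'_def D_def)
        have "inj_on (\<lambda>e. (p e, c' e)) E"
          if p: "p e1 = p e" "\<And>x. x \<in> E \<Longrightarrow> p x = p e \<Longrightarrow> x = e \<or> x = e1"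
            and inj: "inj_on (\<lambda>e. (p e, c e)) D"
          for p :: "'e \<Rightarrow> 'a"
        proof (rule inj_onI)
          fix x y assume xy: "x \<in> E" "y \<in> E" "(p x, c' x) = (p y, c' y)"
          moreover have "x = y" if "x \<in> D" "y \<in> D"
            using inj_onD[OF inj _ that] that xy c'e by simp
          moreover have "z \<in> D \<longleftrightarrow> p z \<noteq> p e" if "z \<in> E" for z
            using that p(1) p(2)[OF that] by (auto simp: D_def)
          ultimately show "x = y"
            using p(2) c'e by (metis prod.inject)
        qed
        from this[of f] this[of g] c e1 e2 fe ge True show ?thesis by blast
      next
        case ne: False
        \<comment> \<open>Contract the path formed by \<open>e1\<close>, \<open>e\<close>, \<open>e2\<close> to the single edge \<open>e2\<close>.\<close>
        define g' where "g' = g(e2 := g e1)"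
        have g1: "g e1 \<noteq> g e" using ge[OF e1(1)] e1(3) ne by blast
        have "at_most_two D g'"
          unfolding at_most_two_def
        proof (intro ballI impI)
          fix x y z assume *: "x \<in> D" "y \<in> D" "z \<in> D" "g' x = g' y \<and> g' y = g' z"
          \<comment> \<open>As \<open>e1\<close> is not in \<open>D\<close>, replacing
            \<open>e2\<close> by \<open>e1\<close> is injective on \<open>D\<close>, and
            \<open>g\<close> after this replacement is \<open>g'\<close>. So the degree bound for
            \<open>g\<close> carries over to \<open>g'\<close>.\<close>
          define s where "s = (\<lambda>x. if x = e2 then e1 else x)"
          have "s x \<in> E \<and> g (s x) = g' x" if "x \<in> D" for x
            using that e1 by (auto simp: s_def D_def g'_def)
          moreover have "x = y" if "s x = s y" "x \<in> D" "y \<in> D" for x y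
            using that by (auto simp: s_def D_def split: if_splits)
          ultimately show "x = y \<or> y = z \<or> x = z"
            using at_most_twoD[OF less.prems(3), of "s x" "s y" "s z"] * by metis
        qed
        then obtain c :: "'e \<Rightarrow> bool" where
          c: "inj_on (\<lambda>e. (f e, c e)) D" "inj_on (\<lambda>e. (g' e, c e)) D"
          using IH[OF D(1)] less.prems D(2) by (meson at_most_two_subset)
        have e2D: "e2 \<in> D" using e2 ne by (auto simp: D_def)
        \<comment> \<open>Undoing the contraction: \<open>e1\<close> takes over the color of
          \<open>e2\<close> at the vertex \<open>g e1\<close>, and \<open>e\<close> in the middle
          gets the opposite color.\<close>
        define c' where "c' = c(e := \<not> c e2, e1 := c e2)"
        have c'D: "c' x = c x" if "x \<in> D" for x
          using that by (auto simp: c'_def D_def)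
        have c'e: "c' e = (\<not> c e2)" "c' e1 = c e2"
          using e1 by (auto simp: c'_def)
        have fD: "f x \<noteq> f e" if "x \<in> D" for x
          using that fe by (auto simp: D_def)
        have gD: "x = e2" if "x \<in> D" "g x = g e" for x
          using that ge by (auto simp: D_def)
        have gD1: "c x \<noteq> c e2" if "x \<in> D" "g x = g e1" for x
        proof
          assume "c x = c e2"
          moreover have "g' x = g' e2" using that by (simp add: g'_def)
          ultimately have "x = e2" using c(2) that(1) e2D by (simp add: inj_on_def)
          then show False using that e2 g1 by simp
        qed
        have gDD: "x = y" if "x \<in> D" "y \<in> D" "g x = g y" "c x = c y" for x y
        proof (cases "x = e2 \<or> y = e2")
          case True
          then show ?thesis using gD that e2 by metis
        next
          case False
          then have "g' x = g' y" using that by (simp add: g'_def)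
          then show ?thesis using c(2) that by (simp add: inj_on_def)
        qed
        have E: "E = insert e (insert e1 D)" using e e1 by (auto simp: D_def)
        have "inj_on (\<lambda>e. (f e, c' e)) E"
        proof (rule inj_onI)
          fix x y assume "x \<in> E" "y \<in> E" "(f x, c' x) = (f y, c' y)"
          then have "x = e \<or> x = e1 \<or> x \<in> D" "y = e \<or> y = e1 \<or> y \<in> D" "f x = f y" "c' x = c' y"
            unfolding E by simp_all
          moreover have "x = y" if "x \<in> D" "y \<in> D"
            using inj_onD[OF c(1) _ that] calculation(3,4) c'D that by simp
          ultimately show "x = y" using fD c'e e1(2) by metis
        qed
        moreover have "inj_on (\<lambda>e. (g e, c' e)) E"
        proof (rule inj_onI)
          fix x y assume "x \<in> E" "y \<in> E" "(g x, c' x) = (g y, c' y)"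
          then have "x = e \<or> x = e1 \<or> x \<in> D" "y = e \<or> y = e1 \<or> y \<in> D" "g x = g y" "c' x = c' y"
            unfolding E by simp_all
          then show "x = y" using gDD gD gD1 g1 c'D c'e by metis
        qed
        ultimately show ?thesis by blast
      qed
    qed
  qed
qed

section \<open>Koenig's edge coloring theorem\<close>

lemma obtain_missing_color:
  assumes "finite B" "card B < k" "c ` B \<subseteq> {..<k :: nat}"
  obtains \<alpha> where "\<alpha> < k" "\<alpha> \<notin> c ` B"
proof -
  have "card (c ` B) < k" using assms(1,2) card_image_le le_less_trans by blast
  then have "\<not> {..<k} \<subseteq> c ` B"
    using assms(1) card_mono[of "c ` B" "{..<k}"] by auto
  then show ?thesis using that by blast
qed

text \<open>Edges are inserted one at a time: before \<open>e\<close> is colored, each of its ends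
  has fewer than \<open>k\<close> edges and so misses a color. The maps \<open>f\<close> and
  \<open>g\<close> may share values, as they do later for the tails and heads of arcs.\<close>

lemma koenig_edge_coloring:
  fixes f g :: "'e \<Rightarrow> 'a"
  assumes "finite E" "\<And>x. card {e \<in> E. f e = x} \<le> k" "\<And>x. card {e \<in> E. g e = x} \<le> k"
  shows "\<exists>c. c ` E \<subseteq> {..<k} \<and> inj_on (\<lambda>e. (f e, c e)) E \<and> inj_on (\<lambda>e. (g e, c e)) E"
  using assms
proof (induction E)
  case empty
  then show ?case by simp
next
  case (insert e E)
  have fiber: "card {x \<in> E. p x = y} \<le> card {x \<in> insert e E. p x = y}" for p :: "'e \<Rightarrow> 'a" and y
    using insert.hyps(1) by (intro card_mono) auto
  obtain c where c: "c ` E \<subseteq> {..<k}"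
    "inj_on (\<lambda>e. (f e, c e)) E" "inj_on (\<lambda>e. (g e, c e)) E"
    using insert.IH insert.prems fiber by (meson le_trans)
  have missing: "\<exists>\<alpha><k. \<forall>x\<in>E. p x = p e \<longrightarrow> c x \<noteq> \<alpha>"
    if "\<And>x. card {e' \<in> insert e E. p e' = x} \<le> k" for p :: "'e \<Rightarrow> 'a"
  proof -
    have "{x \<in> insert e E. p x = p e} = insert e {x \<in> E. p x = p e}" by auto
    then have "card {x \<in> E. p x = p e} < k"
      using that[of "p e"] insert.hyps by simp
    moreover have "c ` {x \<in> E. p x = p e} \<subseteq> {..<k}" using c(1) by auto
    ultimately obtain \<alpha> where "\<alpha> < k" "\<alpha> \<notin> c ` {x \<in> E. p x = p e}"
      using obtain_missing_color[of "{x \<in> E. p x = p e}" k c] insert.hyps(1) by auto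
    then show ?thesis by blast
  qed
  obtain \<alpha> where \<alpha>: "\<alpha> < k" "\<forall>x\<in>E. f x = f e \<longrightarrow> c x \<noteq> \<alpha>"
    using missing[of f] insert.prems(1) by blast
  obtain \<beta> where \<beta>: "\<beta> < k" "\<forall>x\<in>E. g x = g e \<longrightarrow> c x \<noteq> \<beta>"
    using missing[of g] insert.prems(2) by blast
  show ?case
  proof (cases "\<alpha> = \<beta>")
    case True
    with \<alpha> \<beta> c insert.hyps(2) show ?thesis
      by (intro exI[of _ "c(e := \<alpha>)"]) (auto simp: inj_on_def)
  next
    case False
    \<comment> \<open>Recoloring the edges of colors \<open>\<alpha>\<close> and \<open>\<beta>\<close> together with \<open>e\<close> replaces Kempe chains.\<close>
    define D where "D = insert e {x \<in> E. c x \<in> {\<alpha>, \<beta>}}"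
    \<comment> \<open>At an end of \<open>e\<close> one of the two colors is missing, which leaves
      room for \<open>e\<close>; every other vertex has at most one edge of each of them.\<close>
    have two: "at_most_two D p"
      if "inj_on (\<lambda>e. (p e, c e)) E" "\<gamma> \<in> {\<alpha>, \<beta>}" "\<forall>x\<in>E. p x = p e \<longrightarrow> c x \<noteq> \<gamma>"
      for p :: "'e \<Rightarrow> 'a" and \<gamma>
    proof -
      have same: "x = y" if "x \<in> E" "y \<in> E" "p x = p y" "c x = c y" for x y
        using that \<open>inj_on (\<lambda>e. (p e, c e)) E\<close> by (simp add: inj_on_def)
      show ?thesis
        unfolding at_most_two_def D_def using same that(2,3)
        by (smt (verit) insertE insert_iff mem_Collect_eq singletonD)
    qed
    have "finite D" using insert.hyps(1) by (simp add: D_def)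
    then obtain d :: "'e \<Rightarrow> bool" where
      d: "inj_on (\<lambda>e. (f e, d e)) D" "inj_on (\<lambda>e. (g e, d e)) D"
      using two_coloring_exists[of D f g] two[OF c(2), of \<alpha>] two[OF c(3), of \<beta>] \<alpha> \<beta> by auto
    define c' where "c' x = (if x \<in> D then (if d x then \<alpha> else \<beta>) else c x)" for x
    have proper: "inj_on (\<lambda>e. (p e, c' e)) (insert e E)"
      if "inj_on (\<lambda>e. (p e, c e)) E" "inj_on (\<lambda>e. (p e, d e)) D" for p :: "'e \<Rightarrow> 'a"
    proof (rule inj_onI)
      fix x y assume xy: "x \<in> insert e E" "y \<in> insert e E" "(p x, c' x) = (p y, c' y)"
      \<comment> \<open>Both before and after recoloring, edges outside \<open>D\<close> avoid
        \<alpha> and \<beta>, so two edges of equal new color lie both inside or both outside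
        \<open>D\<close>.\<close>
      have in_D: "z \<in> D \<longleftrightarrow> c' z \<in> {\<alpha>, \<beta>}" if "z \<in> insert e E" for z
        using that by (auto simp: c'_def D_def)
      show "x = y"
      proof (cases "x \<in> D")
        case True
        then have "y \<in> D" using in_D[OF xy(1)] in_D[OF xy(2)] xy(3) by simp
        with True show ?thesis
          using that(2) xy(3) False by (auto simp: inj_on_def c'_def split: if_splits)
      next
        case xD: False
        then have "y \<notin> D" using in_D[OF xy(1)] in_D[OF xy(2)] xy(3) by simp
        with xD show ?thesis
          using that(1) xy by (auto simp: inj_on_def c'_def D_def)
      qed
    qed
    have "c' ` insert e E \<subseteq> {..<k}"
      using c(1) \<alpha>(1) \<beta>(1) by (auto simp: c'_def D_def)
    with proper[OF c(2) d(1)] proper[OF c(3) d(2)] show ?thesis by blast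
  qed
qed

section \<open>Balanced two-colorings\<close>

text \<open>Splitting every vertex into vertices of degree two (and one of degree one if its degree is
  odd) makes any proper two-coloring balanced.\<close>

lemma pairing_exists:
  fixes f :: "'e \<Rightarrow> 'a"
  assumes "finite E"
  obtains p :: "'e \<Rightarrow> 'a \<times> nat" where "at_most_two E p"
    "\<And>x. p ` {e \<in> E. f e = x} \<subseteq> {x} \<times> {..<(card {e \<in> E. f e = x} + 1) div 2}"
proof -
  \<comment> \<open>Number the edges at \<open>x\<close> from \<open>0\<close>: those with numbers
    \<open>2 * m\<close> and \<open>2 * m + 1\<close> form the pair \<open>m\<close>, and an odd
    degree leaves the last edge single.\<close>
  have "\<exists>h. bij_betw h {e \<in> E. f e = x} {0..<card {e \<in> E. f e = x}}" for x
    using assms by (intro ex_bij_betw_finite_nat) simp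
  then obtain h where h: "\<And>x. bij_betw (h x) {e \<in> E. f e = x} {0..<card {e \<in> E. f e = x}}"
    by metis
  show ?thesis
  proof
    show "at_most_two E (\<lambda>e. (f e, h (f e) e div 2))"
      unfolding at_most_two_def
    proof (intro ballI impI)
      fix x y z assume *: "x \<in> E" "y \<in> E" "z \<in> E"
        "(f x, h (f x) x div 2) = (f y, h (f y) y div 2) \<and>
         (f y, h (f y) y div 2) = (f z, h (f z) z div 2)"
      define k where "k = h (f x)"
      have "inj_on k {e \<in> E. f e = f x}" using h[of "f x"] by (simp add: k_def bij_betw_def)
      moreover have "k x div 2 = k y div 2" "k y div 2 = k z div 2" using * by (auto simp: k_def)
      then have "k x = k y \<or> k y = k z \<or> k x = k z" by linarith
      ultimately show "x = y \<or> y = z \<or> x = z"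
        using * by (auto simp: inj_on_def)
    qed
    fix x
    have "h x e < card {e \<in> E. f e = x}" if "e \<in> E" "f e = x" for e
      using bij_betwE[OF h[of x]] that by auto
    then show "(\<lambda>e. (f e, h (f e) e div 2)) ` {e \<in> E. f e = x}
        \<subseteq> {x} \<times> {..<(card {e \<in> E. f e = x} + 1) div 2}"
      by fastforce
  qed
qed

text \<open>The two edges of a pair differ in color, so a color occurs at most once per pair. At an
  even degree the bounds for the two colors together force exact halves.\<close>

lemma balanced_two_coloring_exists:
  fixes f g :: "'e \<Rightarrow> 'a"
  assumes "finite E"
  shows "\<exists>c :: 'e \<Rightarrow> bool. \<forall>p\<in>{f, g}. \<forall>x b.
    card {e \<in> E. p e = x \<and> c e = b} \<le> (card {e \<in> E. p e = x} + 1) div 2"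
proof -
  obtain P where P: "at_most_two E P"
    "\<And>x. P ` {e \<in> E. f e = x} \<subseteq> {x} \<times> {..<(card {e \<in> E. f e = x} + 1) div 2}"
    using pairing_exists[OF assms, of f] by blast
  obtain Q where Q: "at_most_two E Q"
    "\<And>x. Q ` {e \<in> E. g e = x} \<subseteq> {x} \<times> {..<(card {e \<in> E. g e = x} + 1) div 2}"
    using pairing_exists[OF assms, of g] by blast
  obtain c :: "'e \<Rightarrow> bool" where
    c: "inj_on (\<lambda>e. (P e, c e)) E" "inj_on (\<lambda>e. (Q e, c e)) E"
    using two_coloring_exists[OF assms P(1) Q(1)] by blast
  have "card {e \<in> E. p e = x \<and> c e = b} \<le> (card {e \<in> E. p e = x} + 1) div 2"
    if R: "R ` {e \<in> E. p e = x} \<subseteq> {x} \<times> {..<(card {e \<in> E. p e = x} + 1) div 2}"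
      and inj: "inj_on (\<lambda>e. (R e, c e)) E" for R :: "'e \<Rightarrow> 'a \<times> nat" and p :: "'e \<Rightarrow> 'a" and x b
  proof -
    have "inj_on R {e \<in> E. p e = x \<and> c e = b}" using inj by (auto simp: inj_on_def)
    then have "card {e \<in> E. p e = x \<and> c e = b} \<le>
        card ({x} \<times> {..<(card {e \<in> E. p e = x} + 1) div 2})"
      using R by (intro card_inj_on_le[of R]) auto
    then show ?thesis by simp
  qed
  note this[OF P(2) c(1)] this[OF Q(2) c(2)]
  then show ?thesis by (intro exI[of _ c] ballI allI) (elim insertE emptyE, simp_all only:)
qed

section \<open>Arc colorings with equal color sets for the two directions\<close>

lemma disjoint_Un_eq_Diff: "P \<inter> Q = {} \<Longrightarrow> P \<union> Q = R \<Longrightarrow> P = R - Q"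
  by blast

lemma balanced_arc_coloring:
  fixes tail head :: "'e \<Rightarrow> 'v"
  assumes "finite E"
    and out: "\<And>v. card {e \<in> E. tail e = v} \<le> r"
    and "in": "\<And>v. card {e \<in> E. head e = v} \<le> r"
  shows "\<exists>c. c ` E \<subseteq> {..<r} \<and> inj_on (\<lambda>e. (tail e, c e)) E \<and> inj_on (\<lambda>e. (head e, c e)) E \<and>
    (\<forall>v. card {e \<in> E. tail e = v} = card {e \<in> E. head e = v} \<longrightarrow>
      c ` {e \<in> E. tail e = v} = c ` {e \<in> E. head e = v})"
proof -
  \<comment> \<open>Loops are added only at balanced vertices that are the tail of some arc, which
    keeps \<open>V\<close> finite.\<close>
  define V where "V = tail ` E \<inter> {v. card {e \<in> E. tail e = v} = card {e \<in> E. head e = v}}"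
  define L where "L = Sigma V (\<lambda>v. {..<r - card {e \<in> E. tail e = v}})"
  \<comment> \<open>A loop \<open>(v, j)\<close> has \<open>v\<close> as its tail and as its head,
    so \<open>F tail\<close> and \<open>F head\<close> agree on \<open>L\<close>.\<close>
  define F where "F p = case_sum p (fst :: 'v \<times> nat \<Rightarrow> 'v)" for p :: "'e \<Rightarrow> 'v"
  have fin: "finite V" "finite L" using \<open>finite E\<close> by (auto simp: V_def L_def)
  have fib: "{a \<in> E <+> L. F p a = v} = {e \<in> E. p e = v} <+> {l \<in> L. fst l = v}" for p v
    by (auto simp: F_def)
  have Lv: "{l \<in> L. fst l = v} = (if v \<in> V then {v} \<times> {..<r - card {e \<in> E. tail e = v}} else {})" for v
    by (auto simp: L_def)
  have card_fib: "card {a \<in> E <+> L. F p a = v} =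
      card {e \<in> E. p e = v} + (if v \<in> V then r - card {e \<in> E. tail e = v} else 0)" for p v
    unfolding fib Lv using \<open>finite E\<close> by (simp add: card_Plus)
  have "card {a \<in> E <+> L. F tail a = v} \<le> r" for v
    unfolding card_fib using out[of v] by auto
  moreover have "card {a \<in> E <+> L. F head a = v} \<le> r" for v
    unfolding card_fib using "in"[of v] by (auto simp: V_def)
  moreover have "finite (E <+> L)" using \<open>finite E\<close> fin by simp
  ultimately obtain c where c: "c ` (E <+> L) \<subseteq> {..<r}"
    "inj_on (\<lambda>a. (F tail a, c a)) (E <+> L)" "inj_on (\<lambda>a. (F head a, c a)) (E <+> L)"
    using koenig_edge_coloring[of "E <+> L" "F tail" r "F head"] by blast
  \<comment> \<open>A padded vertex has exactly \<open>r\<close> arcs on the \<open>p\<close> side,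
    so each color occurs once there and the original arcs use precisely the colors that the loops
    leave over. These do not depend on \<open>p\<close>, so tails and heads give the same
    set.\<close>
  have colors: "c ` Inl ` {e \<in> E. p e = v} = {..<r} - c ` Inr ` {l \<in> L. fst l = v}"
    if inj: "inj_on (\<lambda>a. (F p a, c a)) (E <+> L)" and v: "v \<in> V"
      and p: "card {e \<in> E. p e = v} = card {e \<in> E. tail e = v}" for p v
  proof -
    let ?A = "{a \<in> E <+> L. F p a = v}"
    have inj': "inj_on c ?A" using inj by (auto simp: inj_on_def)
    have "card ?A = r" unfolding card_fib using v p out[of v] by simp
    then have "card (c ` ?A) = card {..<r}" using inj' by (simp add: card_image)
    moreover have "c ` ?A \<subseteq> {..<r}" using c(1) by auto
    ultimately have all: "c ` ?A = {..<r}" by (intro card_subset_eq) auto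
    have A: "?A = Inl ` {e \<in> E. p e = v} \<union> Inr ` {l \<in> L. fst l = v}"
      unfolding fib by (simp add: Plus_def)
    have "c ` Inl ` {e \<in> E. p e = v} \<inter> c ` Inr ` {l \<in> L. fst l = v} = {}"
      using inj_on_image_Int[OF inj', of "Inl ` {e \<in> E. p e = v}" "Inr ` {l \<in> L. fst l = v}"]
      unfolding A by auto
    moreover have "c ` Inl ` {e \<in> E. p e = v} \<union> c ` Inr ` {l \<in> L. fst l = v} = {..<r}"
      using all unfolding A image_Un .
    ultimately show ?thesis by (rule disjoint_Un_eq_Diff)
  qed
  show ?thesis
  proof (intro exI[of _ "c \<circ> Inl"] conjI allI impI)
    show "(c \<circ> Inl) ` E \<subseteq> {..<r}" using c(1) by auto
    show "inj_on (\<lambda>e. (tail e, (c \<circ> Inl) e)) E"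
    proof (rule inj_onI)
      fix x y assume "x \<in> E" "y \<in> E" "(tail x, (c \<circ> Inl) x) = (tail y, (c \<circ> Inl) y)"
      then show "x = y" using inj_onD[OF c(2), of "Inl x" "Inl y"] by (simp add: F_def InlI)
    qed
    show "inj_on (\<lambda>e. (head e, (c \<circ> Inl) e)) E"
    proof (rule inj_onI)
      fix x y assume "x \<in> E" "y \<in> E" "(head x, (c \<circ> Inl) x) = (head y, (c \<circ> Inl) y)"
      then show "x = y" using inj_onD[OF c(3), of "Inl x" "Inl y"] by (simp add: F_def InlI)
    qed
    fix v assume bal: "card {e \<in> E. tail e = v} = card {e \<in> E. head e = v}"
    show "(c \<circ> Inl) ` {e \<in> E. tail e = v} = (c \<circ> Inl) ` {e \<in> E. head e = v}"
    proof (cases "v \<in> V")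
      case True
      then show ?thesis
        using colors[OF c(2) True] colors[OF c(3) True] bal by (simp add: image_comp)
    next
      case False
      \<comment> \<open>A balanced vertex outside \<open>V\<close> is the tail of no arc, hence by
        balance the head of none.\<close>
      then have empty: "{e \<in> E. tail e = v} = {}" using bal by (auto simp: V_def)
      then have "card {e \<in> E. head e = v} = 0" using bal by (metis card.empty)
      then have "{e \<in> E. head e = v} = {}" using \<open>finite E\<close>
        by (metis (no_types, lifting) card_0_eq finite_subset mem_Collect_eq subsetI)
      with empty have "{e \<in> E. tail e = v} = {e \<in> E. head e = v}" by metis
      then show ?thesis by metis
    qed
  qed
qed

text \<open>Since the sides are disjoint, red edges leave and blue ones enter each vertex on the
  \<open>f\<close> side, and conversely on the \<open>g\<close> side. Even degree thus means equal
  in- and out-degree, where \<open>balanced_arc_coloring\<close> equates the color sets.\<close>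

lemma bipartite_block_coloring:
  fixes f g :: "'e \<Rightarrow> 'v"
  assumes "finite E" "f ` E \<inter> g ` E = {}"
    and deg: "\<forall>p\<in>{f, g}. \<forall>x. card {e \<in> E. p e = x} \<le> 2 * r"
  shows "\<exists>(red :: 'e \<Rightarrow> bool) c. c ` E \<subseteq> {..<r} \<and>
    (\<forall>p\<in>{f, g}. inj_on (\<lambda>e. (p e, red e, c e)) E \<and>
      (\<forall>x. even (card {e \<in> E. p e = x}) \<longrightarrow>
        c ` {e \<in> E. p e = x \<and> red e} = c ` {e \<in> E. p e = x \<and> \<not> red e}))"
proof -
  obtain red :: "'e \<Rightarrow> bool" where red: "\<And>p x b. p \<in> {f, g} \<Longrightarrow>
      card {e \<in> E. p e = x \<and> red e = b} \<le> (card {e \<in> E. p e = x} + 1) div 2"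
    using balanced_two_coloring_exists[OF assms(1), of f g] by blast
  define tail where "tail e = (if red e then f e else g e)" for e
  define head where "head e = (if red e then g e else f e)" for e
  \<comment> \<open>Rounding up is harmless: half of a degree of at most \<open>2 * r\<close>,
    rounded up, is still at most \<open>r\<close>.\<close>
  have half: "card {e \<in> E. p e = x \<and> red e = b} \<le> r" if "p \<in> {f, g}" for p x b
    using red[OF that, of x b] spec[OF bspec[OF deg that], of x] by linarith
  have fibf: "{e \<in> E. tail e = x} = {e \<in> E. f e = x \<and> red e = True}"
    "{e \<in> E. head e = x} = {e \<in> E. f e = x \<and> red e = False}" if "x \<notin> g ` E" for x
  proof -
    have "g e \<noteq> x" if "e \<in> E" for e using that \<open>x \<notin> g ` E\<close> by blast
    then show "{e \<in> E. tail e = x} = {e \<in> E. f e = x \<and> red e = True}"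
      "{e \<in> E. head e = x} = {e \<in> E. f e = x \<and> red e = False}"
      by (simp_all add: tail_def head_def cong: conj_cong, auto)
  qed
  have fibg: "{e \<in> E. tail e = x} = {e \<in> E. g e = x \<and> red e = False}"
    "{e \<in> E. head e = x} = {e \<in> E. g e = x \<and> red e = True}" if "x \<notin> f ` E" for x
  proof -
    have "f e \<noteq> x" if "e \<in> E" for e using that \<open>x \<notin> f ` E\<close> by blast
    then show "{e \<in> E. tail e = x} = {e \<in> E. g e = x \<and> red e = False}"
      "{e \<in> E. head e = x} = {e \<in> E. g e = x \<and> red e = True}"
      by (simp_all add: tail_def head_def cong: conj_cong, auto)
  qed
  have side: "x \<notin> g ` E \<or> x \<notin> f ` E" for x using assms(2) by blast
  have "card {e \<in> E. tail e = x} \<le> r" "card {e \<in> E. head e = x} \<le> r" for x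
    using side[of x] fibf[of x] fibg[of x]
      half[of f x True] half[of f x False] half[of g x True] half[of g x False] by auto
  then obtain c where c: "c ` E \<subseteq> {..<r}"
    "inj_on (\<lambda>e. (tail e, c e)) E" "inj_on (\<lambda>e. (head e, c e)) E"
    "\<And>v. card {e \<in> E. tail e = v} = card {e \<in> E. head e = v} \<Longrightarrow>
      c ` {e \<in> E. tail e = v} = c ` {e \<in> E. head e = v}"
    using balanced_arc_coloring[OF assms(1), of tail r head] by blast
  show ?thesis
  proof (intro exI[of _ red] exI[of _ c] conjI ballI allI impI)
    show "c ` E \<subseteq> {..<r}" by fact
    show "inj_on (\<lambda>e. (p e, red e, c e)) E" if "p \<in> {f, g}" for p
      using that c(2,3) unfolding inj_on_def tail_def head_def by (auto split: if_splits)
    fix p x assume p: "p \<in> {f, g}" and ev: "even (card {e \<in> E. p e = x})"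
    have "{e \<in> E. p e = x} = {e \<in> E. p e = x \<and> red e = True} \<union> {e \<in> E. p e = x \<and> red e = False}"
      by auto
    then have "card {e \<in> E. p e = x} =
        card ({e \<in> E. p e = x \<and> red e = True} \<union> {e \<in> E. p e = x \<and> red e = False})" by simp
    also have "\<dots> = card {e \<in> E. p e = x \<and> red e = True} + card {e \<in> E. p e = x \<and> red e = False}"
      using assms(1) by (intro card_Un_disjoint) auto
    finally have eq: "card {e \<in> E. p e = x \<and> red e = True} = card {e \<in> E. p e = x \<and> red e = False}"
      using red[OF p, of x True] red[OF p, of x False] ev by (auto elim!: evenE)
    show "c ` {e \<in> E. p e = x \<and> red e} = c ` {e \<in> E. p e = x \<and> \<not> red e}"
    \<comment> \<open>If \<open>x\<close> is outside the image of \<open>p\<close>, its arcs may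
      belong to the other side of the bipartition, but both color sets in question are
      empty.\<close>
    proof (cases "x \<in> p ` E")
      case True
      with p side[of x] have "p = f \<and> x \<notin> g ` E \<or> p = g \<and> x \<notin> f ` E" by auto
      then show ?thesis
        using c(4)[of x] eq fibf[of x] fibg[of x] by (elim disjE conjE) simp_all
    next
      case False
      then have "{e \<in> E. p e = x \<and> red e} = {}" "{e \<in> E. p e = x \<and> \<not> red e} = {}" by blast+
      then show ?thesis by (simp only: image_empty)
    qed
  qed
qed

section \<open>Blocks of two consecutive colors\<close>

lemma consecutive_singleton: "consecutive {a}"
  unfolding consecutive_def by (rule exI[of _ a], rule exI[of _ a]) simp

lemma consecutive_block: "consecutive {2 * i + 1, 2 * i + 2}"
  unfolding consecutive_def by (rule exI[of _ "2 * i + 1"], rule exI[of _ "2 * i + 2"]) auto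

definition blocks :: "nat set \<Rightarrow> nat set" where
  "blocks C = (\<Union>i\<in>C. {2 * i + 1, 2 * i + 2})"

lemma card_blocks:
  assumes "finite C"
  shows "card (blocks C) = 2 * card C"
proof -
  have "{2 * i + 1, 2 * i + 2} \<inter> {2 * j + 1, 2 * j + 2} = {}" if "i \<noteq> j" for i j :: nat
    using that by auto
  then have "card (blocks C) = (\<Sum>i\<in>C. card {2 * i + 1, 2 * i + 2})"
    unfolding blocks_def using assms by (intro card_UN_disjoint) blast+
  then show ?thesis by simp
qed

lemma blocks_lessThan: "blocks {..<r} = {1..2 * r}"
proof
  show "{1..2 * r} \<subseteq> blocks {..<r}"
  proof
    fix n assume "n \<in> {1..2 * r}"
    then have "(n - 1) div 2 < r" "n = 2 * ((n - 1) div 2) + 1 \<or> n = 2 * ((n - 1) div 2) + 2"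
      by auto
    then show "n \<in> blocks {..<r}" unfolding blocks_def by blast
  qed
qed (auto simp: blocks_def)

text \<open>Blocks of different indices are disjoint, so removing indices removes exactly their
  blocks.\<close>

lemma blocks_Diff: "blocks (A - B) = blocks A - blocks B"
  unfolding blocks_def by auto presburger+

section \<open>From block colorings to cyclic interval colorings\<close>

theorem theorem2:
  fixes G :: "('v, 'e) multigraph" and r :: nat
  assumes "r \<ge> 2"
    and "finite_multigraph G"
    and "bipartite G"
    and "max_degree G = 2 * r - 1"
    and "\<And>v. v \<in> verts G \<Longrightarrow> degree G v \<in> {1, 2, 2 * r - 2, 2 * r - 1}"
  shows "cyclically_interval_colorable G \<and> w_c G \<le> 2 * r"
proof -
  interpret finite_multigraph G by fact
  obtain X Y where XY: "X \<union> Y = verts G" "X \<inter> Y = {}"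
    "\<forall>e \<in> edges G. \<exists>x \<in> X. \<exists>y \<in> Y. ends G e = {x, y}"
    using assms(3) unfolding bipartite_def by blast
  then obtain f g where fg: "\<And>e. e \<in> edges G \<Longrightarrow> f e \<in> X \<and> g e \<in> Y \<and> ends G e = {f e, g e}"
    by metis
  let ?E = "edges G"
  have inc_f: "{e \<in> ?E. f e = v} = incident_edges G v" if "v \<in> X" for v
    using that fg XY(2) by (auto simp: incident_edges_def)
  have inc_g: "{e \<in> ?E. g e = v} = incident_edges G v" if "v \<in> Y" for v
  proof -
    have "f e \<noteq> v" if "e \<in> ?E" for e using fg[OF that] XY(2) \<open>v \<in> Y\<close> by blast
    then have "g e = v \<longleftrightarrow> v \<in> ends G e" if "e \<in> ?E" for e using fg[OF that] that by auto
    then show ?thesis by (auto simp: incident_edges_def)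
  qed
  have inc: "\<exists>p\<in>{f, g}. {e \<in> ?E. p e = v} = incident_edges G v" if "v \<in> verts G" for v
    using that XY(1) inc_f inc_g by blast
  have degree_le: "degree G v \<le> 2 * r" if "v \<in> verts G" for v
    using assms(1) assms(5)[OF that] by auto
  have "card {e \<in> ?E. p e = v} \<le> 2 * r" if p: "p \<in> {f, g}" for p v
  \<comment> \<open>The bound has to hold for every \<open>v\<close> of the vertex type; if
    \<open>v\<close> is not the \<open>p\<close>-end of an edge, the fiber is empty.\<close>
  proof (cases "v \<in> p ` ?E")
    case True
    then have "p = f \<and> v \<in> X \<or> p = g \<and> v \<in> Y" using p fg by blast
    then have "{e \<in> ?E. p e = v} = incident_edges G v" "v \<in> verts G"
      using inc_f inc_g XY(1) by blast+
    then show ?thesis using degree_le by (simp add: degree_def)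
  next
    case False
    then have "{e \<in> ?E. p e = v} = {}" by auto
    then show ?thesis by (metis card.empty zero_le)
  qed
  then have deg: "\<forall>p\<in>{f, g}. \<forall>v. card {e \<in> ?E. p e = v} \<le> 2 * r" by blast
  have disjoint: "f ` ?E \<inter> g ` ?E = {}" using fg XY(2) by fastforce
  obtain red :: "'e \<Rightarrow> bool" and c where c: "c ` ?E \<subseteq> {..<r}"
    and red: "\<forall>p\<in>{f, g}. inj_on (\<lambda>e. (p e, red e, c e)) ?E \<and>
      (\<forall>x. even (card {e \<in> ?E. p e = x}) \<longrightarrow>
        c ` {e \<in> ?E. p e = x \<and> red e} = c ` {e \<in> ?E. p e = x \<and> \<not> red e})"
    using bipartite_block_coloring[OF finite_edges disjoint deg] by (elim exE conjE) (rule that)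
  define \<alpha> where "\<alpha> e = (if red e then 2 * c e + 1 else 2 * c e + 2)" for e
  \<comment> \<open>The parity of \<open>\<alpha> e\<close> recovers \<open>red e\<close>, and then
    its value recovers \<open>c e\<close>.\<close>
  have \<alpha>_eq: "\<alpha> e = \<alpha> e' \<longleftrightarrow> red e = red e' \<and> c e = c e'" for e e'
    unfolding \<alpha>_def by (auto, presburger+)
  have \<alpha>_range: "\<alpha> e \<in> {1..2 * r}" if "e \<in> ?E" for e
    using c that by (force simp: \<alpha>_def)
  have inj_\<alpha>: "e = e'" if "p \<in> {f, g}" "e \<in> ?E" "e' \<in> ?E" "p e = p e'" "\<alpha> e = \<alpha> e'" for p e e'
    using bspec[OF red that(1)] that(2-) unfolding \<alpha>_eq inj_on_def by auto
  have "\<alpha> e \<noteq> \<alpha> e'" if e: "e \<in> ?E" "e' \<in> ?E" and adj: "adjacent_edges G e e'" for e e'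
  proof -
    from adj obtain v where v: "v \<in> ends G e" "v \<in> ends G e'" "e \<noteq> e'"
      unfolding adjacent_edges_def by blast
    then have "v \<in> verts G" using ends_subset e by blast
    then obtain p where p: "p \<in> {f, g}" "{e \<in> ?E. p e = v} = incident_edges G v" using inc by blast
    then have "p e = v" "p e' = v" using e v by (auto simp: incident_edges_def)
    then show ?thesis using inj_\<alpha>[OF p(1) e] v(3) by auto
  qed
  then have proper: "proper_edge_coloring G (2 * r) \<alpha>"
    unfolding proper_edge_coloring_def using \<alpha>_range by blast
  have "consecutive (colors_at G v \<alpha>) \<or> consecutive ({1..2 * r} - colors_at G v \<alpha>)"
    if v: "v \<in> verts G" for v
  proof -
    let ?S = "colors_at G v \<alpha>"
    obtain p where p: "p \<in> {f, g}" and inc_p: "{e \<in> ?E. p e = v} = incident_edges G v"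
      using inc[OF v] by blast
    have "inj_on \<alpha> (incident_edges G v)"
      unfolding inc_p[symmetric] using inj_\<alpha>[OF p] by (auto intro!: inj_onI)
    then have card_S: "card ?S = degree G v"
      unfolding colors_at_def degree_def by (rule card_image)
    have S_sub: "?S \<subseteq> {1..2 * r}"
      using \<alpha>_range unfolding colors_at_def incident_edges_def by blast
    then have card_compl: "card ({1..2 * r} - ?S) = 2 * r - degree G v"
      using card_S by (subst card_Diff_subset) (auto intro: finite_subset)
    \<comment> \<open>At an even degree the red and the blue edges use the same indices
      \<open>C\<close>, so each index contributes both its odd and its even color. The size of
      \<open>C\<close> follows because \<alpha> is injective on the edges at
      \<open>v\<close>.\<close>
    have S_blocks: "\<exists>C \<subseteq> {..<r}. ?S = blocks C \<and> 2 * card C = degree G v" if ev: "even (degree G v)"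
    proof -
      define C where "C = c ` {e \<in> ?E. p e = v}"
      have "c ` {e \<in> ?E. p e = v \<and> red e} = c ` {e \<in> ?E. p e = v \<and> \<not> red e}"
        using ev bspec[OF red p] by (simp add: inc_p degree_def)
      moreover have "C = c ` {e \<in> ?E. p e = v \<and> red e} \<union> c ` {e \<in> ?E. p e = v \<and> \<not> red e}"
        unfolding C_def by blast
      ultimately have C: "C = c ` {e \<in> ?E. p e = v \<and> red e}" "C = c ` {e \<in> ?E. p e = v \<and> \<not> red e}"
        by auto
      have "?S = (\<lambda>i. 2 * i + 1) ` c ` {e \<in> ?E. p e = v \<and> red e} \<union>
          (\<lambda>i. 2 * i + 2) ` c ` {e \<in> ?E. p e = v \<and> \<not> red e}"
        unfolding colors_at_def inc_p[symmetric] by (auto simp: \<alpha>_def image_iff)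
      also have "\<dots> = blocks C"
        unfolding C(1)[symmetric] C(2)[symmetric] by (auto simp: blocks_def)
      finally have S: "?S = blocks C" .
      have "C \<subseteq> {..<r}" using c unfolding C_def by blast
      moreover from this have "2 * card C = degree G v"
        using card_blocks[of C] card_S S finite_subset[of C "{..<r}"] by simp
      ultimately show ?thesis using S by blast
    qed
    from assms(5)[OF v] consider "degree G v = 1" | "degree G v = 2" |
      "degree G v = 2 * r - 2" | "degree G v = 2 * r - 1" by blast
    then show ?thesis
    proof cases
      case 1
      then obtain a where "?S = {a}" using card_S by (metis card_1_singletonE)
      then show ?thesis using consecutive_singleton by metis
    next
      case 2
      then obtain C where C: "?S = blocks C" "2 * card C = 2" using S_blocks by auto
      then have "card C = 1" by linarith
      then obtain i where "C = {i}" by (metis card_1_singletonE)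
      then have "?S = {2 * i + 1, 2 * i + 2}" using C(1) by (simp add: blocks_def)
      then show ?thesis using consecutive_block by metis
    next
      case 3
      then obtain C where C: "C \<subseteq> {..<r}" "?S = blocks C" "2 * card C = 2 * r - 2"
        using S_blocks by auto
      \<comment> \<open>Here \<open>C\<close> has \<open>r - 1\<close> elements, so the missing
        colors form the block of the one remaining index.\<close>
      have "card ({..<r} - C) = r - card C"
        using C(1) finite_subset[of C "{..<r}"] by (subst card_Diff_subset) auto
      then have "card ({..<r} - C) = 1" using C(3) assms(1) by linarith
      then obtain i where "{..<r} - C = {i}" by (metis card_1_singletonE)
      then have "{1..2 * r} - ?S = {2 * i + 1, 2 * i + 2}"
        unfolding C(2) blocks_lessThan[symmetric] blocks_Diff[symmetric] by (simp add: blocks_def)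
      then show ?thesis using consecutive_block by metis
    next
      case 4
      then have "card ({1..2 * r} - ?S) = 1" using card_compl assms(1) by simp
      then obtain a where "{1..2 * r} - ?S = {a}" by (metis card_1_singletonE)
      then show ?thesis using consecutive_singleton by metis
    qed
  qed
  with proper have "cyclic_interval_coloring G (2 * r) \<alpha>"
    unfolding cyclic_interval_coloring_def by blast
  then have "2 * r > 0 \<and> (\<exists>\<alpha>. cyclic_interval_coloring G (2 * r) \<alpha>)" using assms(1) by auto
  then show ?thesis
    unfolding cyclically_interval_colorable_def w_c_def by (blast intro: Least_le)
qed

end
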